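(* Let $A$ be a torsion-free (discrete) abelian group and $C$ a torsion (discrete) abelian group. Then $Pext(C,A)=0$.
   Context: All groups are discrete abelian groups. $Ext(C,A)$ is the group of equivalence classes of extensions $0\to A\stackrel{\phi}{\to} B\stackrel{\psi}{\to} C\to 0$ (short exact sequences). A subgroup $H$ of a group $B$ is pure if $nH=H\cap nB$ for all positive integers $n$; the extension is pure if $\phi(A)$ is pure in $B$, and $Pext(C,A)$ is the subgroup of $Ext(C,A)$ of elements represented by pure extensions. *)

theory Defs
  imports "HOL-Algebra.Elementary_Groups"
begin

definition torsion_group :: "('a, 'm) monoid_scheme \<Rightarrow> bool" where
  "torsion_group G \<longleftrightarrow> (\<forall>x\<in>carrier G. \<exists>n::nat. n > 0 \<and> x [^]\<^bsub>G\<^esub> n = \<one>\<^bsub>G\<^esub>)"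

definition torsion_free_group :: "('a, 'm) monoid_scheme \<Rightarrow> bool" where
  "torsion_free_group G \<longleftrightarrow>
     (\<forall>x\<in>carrier G. \<forall>n::nat. n > 0 \<longrightarrow> x [^]\<^bsub>G\<^esub> n = \<one>\<^bsub>G\<^esub> \<longrightarrow> x = \<one>\<^bsub>G\<^esub>)"

text \<open>Groups are written multiplicatively, so \<open>n H\<close> is the set of \<open>n\<close>-th powers of elements of \<open>H\<close>.\<close>

definition pure_subgroup :: "'b set \<Rightarrow> ('b, 'm) monoid_scheme \<Rightarrow> bool" where
  "pure_subgroup H G \<longleftrightarrow> subgroup H G \<and>
     (\<forall>n::nat. n > 0 \<longrightarrow>
        (\<lambda>x. x [^]\<^bsub>G\<^esub> n) ` H = H \<inter> (\<lambda>x. x [^]\<^bsub>G\<^esub> n) ` carrier G)"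

record ('a, 'b, 'c) extn =
  mid :: "'b monoid"
  incl :: "'a \<Rightarrow> 'b"
  proj :: "'b \<Rightarrow> 'c"

definition is_ext :: "'a monoid \<Rightarrow> 'c monoid \<Rightarrow> ('a, 'b, 'c) extn \<Rightarrow> bool" where
  "is_ext A C E \<longleftrightarrow> comm_group (mid E) \<and> incl E \<in> mon A (mid E) \<and> proj E \<in> epi (mid E) C \<and>
     incl E ` carrier A = kernel (mid E) C (proj E)"

definition ext_equiv ::
  "'a monoid \<Rightarrow> ('a, 'b, 'c) extn \<Rightarrow> ('a, 'd, 'c) extn \<Rightarrow> bool" where
  "ext_equiv A E E' \<longleftrightarrow> (\<exists>h \<in> iso (mid E) (mid E').
     (\<forall>a\<in>carrier A. h (incl E a) = incl E' a) \<and>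
     (\<forall>b\<in>carrier (mid E). proj E' (h b) = proj E b))"

text \<open>
  To make the classes of extensions a set, middle groups are taken on subsets of the type
  \<^typ>\<open>'a \<times> 'c\<close>; by \<open>ext_representative\<close> below every extension, whatever the type
  of its middle group, is equivalent to such an extension.  Values outside the carriers are
  irrelevant, since \<open>ext_equiv\<close> compares maps on the carriers only.
\<close>

definition ext_rel ::
  "'c monoid \<Rightarrow> 'a monoid \<Rightarrow> (('a, 'a \<times> 'c, 'c) extn \<times> ('a, 'a \<times> 'c, 'c) extn) set" where
  "ext_rel C A = {(E, E'). is_ext A C E \<and> is_ext A C E' \<and> ext_equiv A E E'}"

definition ext_class ::
  "'c monoid \<Rightarrow> 'a monoid \<Rightarrow> ('a, 'b, 'c) extn \<Rightarrow> ('a, 'a \<times> 'c, 'c) extn set" where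
  "ext_class C A E = {E'. is_ext A C E' \<and> ext_equiv A E E'}"

definition split_ext :: "'a monoid \<Rightarrow> 'c monoid \<Rightarrow> ('a, 'a \<times> 'c, 'c) extn" where
  "split_ext A C = \<lparr>mid = A \<times>\<times> C, incl = (\<lambda>a. (a, \<one>\<^bsub>C\<^esub>)), proj = snd\<rparr>"

text \<open>
  Baer sum: the fibre product of the middle groups over \<open>C\<close>, modulo the antidiagonal copy of \<open>A\<close>.
\<close>

definition fibre_prod :: "('a, 'b, 'c) extn \<Rightarrow> ('a, 'd, 'c) extn \<Rightarrow> ('b \<times> 'd) monoid" where
  "fibre_prod E E' = (mid E \<times>\<times> mid E')
     \<lparr>carrier := {(x, y) \<in> carrier (mid E) \<times> carrier (mid E'). proj E x = proj E' y}\<rparr>"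

definition antidiag :: "'a monoid \<Rightarrow> ('a, 'b, 'c) extn \<Rightarrow> ('a, 'd, 'c) extn \<Rightarrow> ('b \<times> 'd) set" where
  "antidiag A E E' = (\<lambda>a. (incl E a, inv\<^bsub>mid E'\<^esub> incl E' a)) ` carrier A"

definition baer_sum ::
  "'a monoid \<Rightarrow> ('a, 'b, 'c) extn \<Rightarrow> ('a, 'd, 'c) extn \<Rightarrow> ('a, ('b \<times> 'd) set, 'c) extn" where
  "baer_sum A E E' =
     \<lparr>mid = fibre_prod E E' Mod antidiag A E E',
      incl = (\<lambda>a. antidiag A E E' #>\<^bsub>fibre_prod E E'\<^esub> (incl E a, \<one>\<^bsub>mid E'\<^esub>)),
      proj = (\<lambda>K. the_elem ((\<lambda>(x, y). proj E x) ` K))\<rparr>"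

definition Ext :: "'c monoid \<Rightarrow> 'a monoid \<Rightarrow> ('a, 'a \<times> 'c, 'c) extn set monoid" where
  "Ext C A =
     \<lparr>carrier = {E. is_ext A C E} // ext_rel C A,
      mult = (\<lambda>X Y. \<Union>E\<in>X. \<Union>E'\<in>Y. ext_class C A (baer_sum A E E')),
      one = ext_class C A (split_ext A C)\<rparr>"

definition pure_ext :: "'a monoid \<Rightarrow> ('a, 'b, 'c) extn \<Rightarrow> bool" where
  "pure_ext A E \<longleftrightarrow> pure_subgroup (incl E ` carrier A) (mid E)"

definition Pext :: "'c monoid \<Rightarrow> 'a monoid \<Rightarrow> ('a, 'a \<times> 'c, 'c) extn set monoid" where
  "Pext C A = (Ext C A)\<lparr>carrier := {X \<in> carrier (Ext C A). \<exists>E\<in>X. pure_ext A E}\<rparr>"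

lemma ext_equivI:
  assumes "h \<in> iso (mid E) (mid E')"
    "\<And>a. a \<in> carrier A \<Longrightarrow> h (incl E a) = incl E' a"
    "\<And>b. b \<in> carrier (mid E) \<Longrightarrow> proj E' (h b) = proj E b"
  shows "ext_equiv A E E'"
  using assms unfolding ext_equiv_def by blast

lemma ext_equiv_trans:
  assumes "ext_equiv A E F" "ext_equiv A F G"
  shows "ext_equiv A E G"
proof -
  obtain h where h: "h \<in> iso (mid E) (mid F)" "\<forall>a\<in>carrier A. h (incl E a) = incl F a"
      "\<forall>b\<in>carrier (mid E). proj F (h b) = proj E b"
    using assms(1) unfolding ext_equiv_def by blast
  obtain k where k: "k \<in> iso (mid F) (mid G)" "\<forall>a\<in>carrier A. k (incl F a) = incl G a"
      "\<forall>b\<in>carrier (mid F). proj G (k b) = proj F b"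
    using assms(2) unfolding ext_equiv_def by blast
  have "h b \<in> carrier (mid F)" if "b \<in> carrier (mid E)" for b
    using that h(1) by (auto simp: iso_def hom_def)
  then show ?thesis
    using h k by (intro ext_equivI[of "k \<circ> h"]) (auto intro: iso_set_trans)
qed

lemma extD:
  assumes "is_ext A C E"
  shows "comm_group (mid E)" "incl E \<in> hom A (mid E)" "inj_on (incl E) (carrier A)"
    "proj E \<in> hom (mid E) C" "proj E ` carrier (mid E) = carrier C"
    "incl E ` carrier A = kernel (mid E) C (proj E)"
  using assms by (auto simp: is_ext_def mon_def epi_def)

lemma ext_equiv_sym:
  assumes "is_ext A C E" "ext_equiv A E F"
  shows "ext_equiv A F E"
proof -
  interpret B: comm_group "mid E" using extD[OF assms(1)] by blast
  obtain h where h: "h \<in> iso (mid E) (mid F)" "\<forall>a\<in>carrier A. h (incl E a) = incl F a"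
      "\<forall>b\<in>carrier (mid E). proj F (h b) = proj E b"
    using assms(2) unfolding ext_equiv_def by blast
  let ?k = "inv_into (carrier (mid E)) h"
  have i: "?k \<in> iso (mid F) (mid E)" using B.iso_set_sym h(1) by blast
  have b: "bij_betw h (carrier (mid E)) (carrier (mid F))" using h(1) by (auto simp: iso_def)
  have 1: "?k (h x) = x" if "x \<in> carrier (mid E)" for x
    using b that by (simp add: bij_betw_def)
  have c: "incl E a \<in> carrier (mid E)" if "a \<in> carrier A" for a
    using extD(2)[OF assms(1)] that by (auto simp: hom_def)
  show ?thesis
  proof (rule ext_equivI[OF i])
    show "?k (incl F a) = incl E a" if "a \<in> carrier A" for a
      using 1[OF c[OF that]] h(2) that by simp
    show "proj E (?k y) = proj F y" if "y \<in> carrier (mid F)" for y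
    proof -
      obtain x where "x \<in> carrier (mid E)" "y = h x" using b \<open>y \<in> _\<close> by (auto simp: bij_betw_def)
      then show ?thesis using 1 h(3) by simp
    qed
  qed
qed

lemma ext_equiv_refl: "ext_equiv A E E"
  by (rule ext_equivI[of id]) (auto simp: iso_def hom_def)

lemma ext_transport:
  fixes E :: "('a, 'b, 'c) extn" and h :: "'b \<Rightarrow> 'd"
  assumes E: "is_ext A C E" and inj: "inj_on h (carrier (mid E))"
  shows "\<exists>E' :: ('a, 'd, 'c) extn. is_ext A C E' \<and> ext_equiv A E E'"
proof -
  interpret B: comm_group "mid E" using extD[OF E] by blast
  let ?k = "inv_into (carrier (mid E)) h"
  define D where "D = \<lparr>carrier = h ` carrier (mid E), 
    mult = (\<lambda>x y. h (?k x \<otimes>\<^bsub>mid E\<^esub> ?k y)), one = h \<one>\<^bsub>mid E\<^esub>\<rparr>"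
  define E' where "E' = \<lparr>mid = D, incl = h \<circ> incl E, proj = proj E \<circ> ?k\<rparr>"
  have k: "?k (h x) = x" if "x \<in> carrier (mid E)" for x using inj that by simp
  have c: "incl E a \<in> carrier (mid E)" if "a \<in> carrier A" for a
    using extD(2)[OF E] that by (auto simp: hom_def)
  have hc: "h x = h y \<longleftrightarrow> x = y" if "x \<in> carrier (mid E)" "y \<in> carrier (mid E)" for x y
    using inj that by (auto simp: inj_on_def)
  have D: "comm_group D"
  proof (rule comm_groupI)
    show "\<exists>y\<in>carrier D. y \<otimes>\<^bsub>D\<^esub> x = \<one>\<^bsub>D\<^esub>" if x: "x \<in> carrier D" for x
    proof -
      obtain z where "z \<in> carrier (mid E)" "x = h z" using x by (auto simp: D_def)
      then show ?thesis by (intro bexI[of _ "h (inv\<^bsub>mid E\<^esub> z)"]) (auto simp: D_def k)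
    qed
  qed (auto simp: D_def k B.m_ac)
  have h: "h \<in> iso (mid E) D" using inj by (auto simp: D_def iso_def hom_def k bij_betw_def)
  have "is_ext A C E'"
    unfolding is_ext_def mon_def epi_def
  proof (intro conjI CollectI)
    show "comm_group (mid E')" using D by (simp add: E'_def)
    show "incl E' \<in> hom A (mid E')"
      using h extD(2)[OF E] by (auto simp: E'_def iso_def intro: hom_compose)
    show "inj_on (incl E') (carrier A)"
      using extD(3)[OF E] c inj by (auto simp: E'_def inj_on_def)
    show "proj E' \<in> hom (mid E') C"
      using extD(4)[OF E] by (auto simp: E'_def D_def hom_def k)
    show "proj E' ` carrier (mid E') = carrier C"
      using extD(5)[OF E] by (force simp: E'_def D_def k image_image)
    have "incl E' ` carrier A = h ` kernel (mid E) C (proj E)"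
      using extD(6)[OF E] by (metis E'_def extn.select_convs(2) image_comp)
    also have "\<dots> = kernel (mid E') C (proj E')"
      by (auto simp: E'_def D_def k kernel_def)
    finally show "incl E' ` carrier A = kernel (mid E') C (proj E')" .
  qed
  moreover have "ext_equiv A E E'"
    using h k by (intro ext_equivI[of h]) (auto simp: E'_def)
  ultimately show ?thesis by blast
qed

text \<open>
  The Baer sum makes \<open>Ext C A\<close> a commutative group (\<open>Ext_comm_group\<close>) with
  \<open>Pext C A\<close> as a subgroup (\<open>Pext_subgroup\<close>).  The proof goes through factor sets:
  two extensions are equivalent if some choice of sections gives them the same factor set \<open>f\<close>,
  and the Baer sum multiplies factor sets pointwise.
\<close>

definition section_of where
  "section_of A C E s f \<longleftrightarrow>
     (\<forall>c\<in>carrier C. s c \<in> carrier (mid E) \<and> proj E (s c) = c) \<and>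
     (\<forall>c\<in>carrier C. \<forall>d\<in>carrier C. f c d \<in> carrier A \<and>
        s c \<otimes>\<^bsub>mid E\<^esub> s d = incl E (f c d) \<otimes>\<^bsub>mid E\<^esub> s (c \<otimes>\<^bsub>C\<^esub> d))"

definition has_factor_set where
  "has_factor_set A C E f \<longleftrightarrow> (\<exists>s. section_of A C E s f)"

locale ab_pair = A: comm_group A + C: comm_group C
  for A :: "'a monoid" and C :: "'c monoid"
begin

lemma fibre:
  assumes E: "is_ext A C E" and "x \<in> carrier (mid E)" "y \<in> carrier (mid E)" "proj E x = proj E y"
  shows "\<exists>a\<in>carrier A. x = incl E a \<otimes>\<^bsub>mid E\<^esub> y"
proof -
  interpret B: comm_group "mid E" using extD[OF E] by blast
  interpret p: group_hom "mid E" C "proj E"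
    by (simp add: group_hom_def group_hom_axioms_def extD[OF E])
  have "x \<otimes>\<^bsub>mid E\<^esub> inv\<^bsub>mid E\<^esub> y \<in> kernel (mid E) C (proj E)"
    using assms by (simp add: kernel_def)
  then obtain a where "a \<in> carrier A" "x \<otimes>\<^bsub>mid E\<^esub> inv\<^bsub>mid E\<^esub> y = incl E a"
    using extD(6)[OF E] by blast
  moreover from this have "x = incl E a \<otimes>\<^bsub>mid E\<^esub> y"
    using assms by (metis B.inv_solve_right' B.inv_closed B.m_closed)
  ultimately show ?thesis by blast
qed

lemma ext_simps:
  assumes E: "is_ext A C E"
  shows "a \<in> carrier A \<Longrightarrow> incl E a \<in> carrier (mid E)"
    "a \<in> carrier A \<Longrightarrow> proj E (incl E a) = \<one>\<^bsub>C\<^esub>"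
    "a \<in> carrier A \<Longrightarrow> b \<in> carrier A \<Longrightarrow>
       incl E (a \<otimes>\<^bsub>A\<^esub> b) = incl E a \<otimes>\<^bsub>mid E\<^esub> incl E b"
    "a \<in> carrier A \<Longrightarrow> b \<in> carrier A \<Longrightarrow> incl E a = incl E b \<longleftrightarrow> a = b"
    "x \<in> carrier (mid E) \<Longrightarrow> proj E x \<in> carrier C"
    "x \<in> carrier (mid E) \<Longrightarrow> y \<in> carrier (mid E) \<Longrightarrow>
       proj E (x \<otimes>\<^bsub>mid E\<^esub> y) = proj E x \<otimes>\<^bsub>C\<^esub> proj E y"
    "incl E \<one>\<^bsub>A\<^esub> = \<one>\<^bsub>mid E\<^esub>" "proj E \<one>\<^bsub>mid E\<^esub> = \<one>\<^bsub>C\<^esub>"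
    "a \<in> carrier A \<Longrightarrow> incl E (inv\<^bsub>A\<^esub> a) = inv\<^bsub>mid E\<^esub> incl E a"
proof -
  interpret B: comm_group "mid E" using extD[OF E] by blast
  interpret p: group_hom "mid E" C "proj E"
    by (simp add: group_hom_def group_hom_axioms_def extD[OF E])
  interpret i: group_hom A "mid E" "incl E"
    by (simp add: group_hom_def group_hom_axioms_def extD[OF E])
  show "a \<in> carrier A \<Longrightarrow> proj E (incl E a) = \<one>\<^bsub>C\<^esub>"
    using extD(6)[OF E] by (auto simp: kernel_def)
  show "a \<in> carrier A \<Longrightarrow> b \<in> carrier A \<Longrightarrow> incl E a = incl E b \<longleftrightarrow> a = b"
    using extD(3)[OF E] by (auto simp: inj_on_def)
  show "a \<in> carrier A \<Longrightarrow> incl E a \<in> carrier (mid E)" by (rule i.hom_closed)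
  show "a \<in> carrier A \<Longrightarrow> b \<in> carrier A \<Longrightarrow>
       incl E (a \<otimes>\<^bsub>A\<^esub> b) = incl E a \<otimes>\<^bsub>mid E\<^esub> incl E b" by (rule i.hom_mult)
  show "x \<in> carrier (mid E) \<Longrightarrow> proj E x \<in> carrier C" by (rule p.hom_closed)
  show "x \<in> carrier (mid E) \<Longrightarrow> y \<in> carrier (mid E) \<Longrightarrow>
       proj E (x \<otimes>\<^bsub>mid E\<^esub> y) = proj E x \<otimes>\<^bsub>C\<^esub> proj E y" by (rule p.hom_mult)
  show "incl E \<one>\<^bsub>A\<^esub> = \<one>\<^bsub>mid E\<^esub>" by (rule i.hom_one)
  show "proj E \<one>\<^bsub>mid E\<^esub> = \<one>\<^bsub>C\<^esub>" by (rule p.hom_one)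
  show "a \<in> carrier A \<Longrightarrow> incl E (inv\<^bsub>A\<^esub> a) = inv\<^bsub>mid E\<^esub> incl E a" by (rule i.hom_inv)
qed

lemma factor_set_exists:
  assumes E: "is_ext A C E"
  shows "\<exists>f. has_factor_set A C E f"
proof -
  interpret B: comm_group "mid E" using extD[OF E] by blast
  obtain s where s: "\<And>c. c \<in> carrier C \<Longrightarrow> s c \<in> carrier (mid E) \<and> proj E (s c) = c"
    using extD(5)[OF E] by (metis (mono_tags) image_iff)
  have "\<exists>a\<in>carrier A. s c \<otimes>\<^bsub>mid E\<^esub> s d = incl E a \<otimes>\<^bsub>mid E\<^esub> s (c \<otimes>\<^bsub>C\<^esub> d)"
    if "c \<in> carrier C" "d \<in> carrier C" for c d
    using that s by (intro fibre[OF E]) (auto simp: ext_simps[OF E])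
  then obtain f where "\<And>c d. c \<in> carrier C \<Longrightarrow> d \<in> carrier C \<Longrightarrow> f c d \<in> carrier A \<and>
      s c \<otimes>\<^bsub>mid E\<^esub> s d = incl E (f c d) \<otimes>\<^bsub>mid E\<^esub> s (c \<otimes>\<^bsub>C\<^esub> d)"
    by metis
  then show ?thesis using s unfolding has_factor_set_def section_of_def by blast
qed

lemma section_bij:
  assumes E: "is_ext A C E" and s: "section_of A C E s f"
  shows "bij_betw (\<lambda>(a, c). incl E a \<otimes>\<^bsub>mid E\<^esub> s c) (carrier A \<times> carrier C) (carrier (mid E))"
  unfolding bij_betw_def
proof
  interpret B: comm_group "mid E" using extD[OF E] by blast
  note [simp] = ext_simps[OF E]
  have s: "s c \<in> carrier (mid E)" "proj E (s c) = c" if "c \<in> carrier C" for c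
    using s that by (auto simp: section_of_def)
  note [simp] = s
  show "inj_on (\<lambda>(a, c). incl E a \<otimes>\<^bsub>mid E\<^esub> s c) (carrier A \<times> carrier C)"
  proof (rule inj_onI, clarsimp)
    fix a c a' c'
    assume *: "a \<in> carrier A" "c \<in> carrier C" "a' \<in> carrier A" "c' \<in> carrier C"
      "incl E a \<otimes>\<^bsub>mid E\<^esub> s c = incl E a' \<otimes>\<^bsub>mid E\<^esub> s c'"
    have "proj E (incl E a \<otimes>\<^bsub>mid E\<^esub> s c) = proj E (incl E a' \<otimes>\<^bsub>mid E\<^esub> s c')" using * by simp
    then have "c = c'" using *(1-4) by simp
    then show "a = a' \<and> c = c'" using * by simp
  qed
  show "(\<lambda>(a, c). incl E a \<otimes>\<^bsub>mid E\<^esub> s c) ` (carrier A \<times> carrier C) = carrier (mid E)"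
  proof
    show "carrier (mid E) \<subseteq> (\<lambda>(a, c). incl E a \<otimes>\<^bsub>mid E\<^esub> s c) ` (carrier A \<times> carrier C)"
    proof
      fix x assume x: "x \<in> carrier (mid E)"
      then obtain a where "a \<in> carrier A" "x = incl E a \<otimes>\<^bsub>mid E\<^esub> s (proj E x)"
        using fibre[OF E, of x "s (proj E x)"] by auto
      then show "x \<in> (\<lambda>(a, c). incl E a \<otimes>\<^bsub>mid E\<^esub> s c) ` (carrier A \<times> carrier C)"
        using x by (intro image_eqI[of _ _ "(a, proj E x)"]) auto
    qed
  qed auto
qed

lemma ext_representative:
  fixes E :: "('a, 'b, 'c) extn"
  assumes E: "is_ext A C E"
  shows "\<exists>E' :: ('a, 'a \<times> 'c, 'c) extn. is_ext A C E' \<and> ext_equiv A E E'"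
proof -
  obtain s f where "section_of A C E s f"
    using factor_set_exists[OF E] unfolding has_factor_set_def by blast
  from section_bij[OF E this] show ?thesis
    by (intro ext_transport[OF E]) (blast dest: bij_betw_inv_into bij_betw_imp_inj_on)
qed

lemma factor_set_equiv:
  assumes E: "is_ext A C E" and E': "is_ext A C E'"
    and "has_factor_set A C E f" "has_factor_set A C E' f"
  shows "ext_equiv A E E'"
proof -
  interpret B: comm_group "mid E" using extD[OF E] by blast
  interpret B': comm_group "mid E'" using extD[OF E'] by blast
  obtain s s' where s: "section_of A C E s f" and s': "section_of A C E' s' f"
    using assms by (auto simp: has_factor_set_def)
  define m where "m = (\<lambda>(a, c). incl E a \<otimes>\<^bsub>mid E\<^esub> s c)"
  define m' where "m' = (\<lambda>(a, c). incl E' a \<otimes>\<^bsub>mid E'\<^esub> s' c)"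
  have bij: "bij_betw m (carrier A \<times> carrier C) (carrier (mid E))"
    using section_bij[OF E s] by (simp add: m_def)
  have bij': "bij_betw m' (carrier A \<times> carrier C) (carrier (mid E'))"
    using section_bij[OF E' s'] by (simp add: m'_def)
  have sc: "s c \<in> carrier (mid E)" "proj E (s c) = c" "s' c \<in> carrier (mid E')" "proj E' (s' c) = c"
    if "c \<in> carrier C" for c
    using s s' that by (auto simp: section_of_def)
  have f: "f c d \<in> carrier A" "s c \<otimes>\<^bsub>mid E\<^esub> s d = incl E (f c d) \<otimes>\<^bsub>mid E\<^esub> s (c \<otimes>\<^bsub>C\<^esub> d)"
    "s' c \<otimes>\<^bsub>mid E'\<^esub> s' d = incl E' (f c d) \<otimes>\<^bsub>mid E'\<^esub> s' (c \<otimes>\<^bsub>C\<^esub> d)"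
    if "c \<in> carrier C" "d \<in> carrier C" for c d
    using s s' that by (auto simp: section_of_def)
  note [simp] = ext_simps[OF E] ext_simps[OF E']
  define t where "t = inv_into (carrier A \<times> carrier C) m"
  define h where "h = m' \<circ> t"
  have t: "t (m (a, c)) = (a, c)" if "a \<in> carrier A" "c \<in> carrier C" for a c
    using bij that by (simp add: t_def bij_betw_def)
  have surj: "\<exists>a\<in>carrier A. \<exists>c\<in>carrier C. x = m (a, c)" if "x \<in> carrier (mid E)" for x
  proof -
    have "x \<in> m ` (carrier A \<times> carrier C)" using bij that by (simp add: bij_betw_def)
    then show ?thesis by auto
  qed
  have mm: "m (a, c) \<otimes>\<^bsub>mid E\<^esub> m (b, d) = m (a \<otimes>\<^bsub>A\<^esub> b \<otimes>\<^bsub>A\<^esub> f c d, c \<otimes>\<^bsub>C\<^esub> d)"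
    if "a \<in> carrier A" "b \<in> carrier A" "c \<in> carrier C" "d \<in> carrier C" for a b c d
  proof -
    have "m (a, c) \<otimes>\<^bsub>mid E\<^esub> m (b, d)
        = (incl E a \<otimes>\<^bsub>mid E\<^esub> incl E b) \<otimes>\<^bsub>mid E\<^esub> (s c \<otimes>\<^bsub>mid E\<^esub> s d)"
      using that sc by (simp add: m_def B.m_ac)
    then show ?thesis using that sc f by (simp add: m_def B.m_ac)
  qed
  have mm': "m' (a, c) \<otimes>\<^bsub>mid E'\<^esub> m' (b, d) = m' (a \<otimes>\<^bsub>A\<^esub> b \<otimes>\<^bsub>A\<^esub> f c d, c \<otimes>\<^bsub>C\<^esub> d)"
    if "a \<in> carrier A" "b \<in> carrier A" "c \<in> carrier C" "d \<in> carrier C" for a b c d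
  proof -
    have "m' (a, c) \<otimes>\<^bsub>mid E'\<^esub> m' (b, d)
        = (incl E' a \<otimes>\<^bsub>mid E'\<^esub> incl E' b) \<otimes>\<^bsub>mid E'\<^esub> (s' c \<otimes>\<^bsub>mid E'\<^esub> s' d)"
      using that sc by (simp add: m'_def B'.m_ac)
    then show ?thesis using that sc f by (simp add: m'_def B'.m_ac)
  qed
  have hm: "h (m (a, c)) = m' (a, c)" if "a \<in> carrier A" "c \<in> carrier C" for a c
    using t that by (simp add: h_def)
  have bijh: "bij_betw h (carrier (mid E)) (carrier (mid E'))"
    unfolding h_def t_def using bij bij' by (blast intro: bij_betw_trans bij_betw_inv_into)
  have homh: "h (x \<otimes>\<^bsub>mid E\<^esub> y) = h x \<otimes>\<^bsub>mid E'\<^esub> h y"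
    if xy: "x \<in> carrier (mid E)" "y \<in> carrier (mid E)" for x y
  proof -
    obtain a c b d where "a \<in> carrier A" "c \<in> carrier C" "x = m (a, c)"
      "b \<in> carrier A" "d \<in> carrier C" "y = m (b, d)" using surj xy by metis
    then show ?thesis using f by (simp add: mm mm' hm)
  qed
  show ?thesis
  proof (rule ext_equivI[of h])
    show "h \<in> iso (mid E) (mid E')"
      using bijh homh by (auto simp: iso_def hom_def bij_betw_def)
    show "proj E' (h x) = proj E x" if x: "x \<in> carrier (mid E)" for x
    proof -
      obtain a c where ac: "a \<in> carrier A" "c \<in> carrier C" "x = m (a, c)" using surj x by metis
      have "proj E x = c" "proj E' (m' (a, c)) = c" using ac sc by (auto simp: m_def m'_def)
      then show ?thesis using ac hm by simp
    qed
    show "h (incl E a) = incl E' a" if a: "a \<in> carrier A" for a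
    proof -
      let ?u = "f \<one>\<^bsub>C\<^esub> \<one>\<^bsub>C\<^esub>"
      have u: "?u \<in> carrier A" using f by simp
      have 1: "s \<one>\<^bsub>C\<^esub> = incl E ?u" and 2: "s' \<one>\<^bsub>C\<^esub> = incl E' ?u"
        using f[of "\<one>\<^bsub>C\<^esub>" "\<one>\<^bsub>C\<^esub>"] sc[of "\<one>\<^bsub>C\<^esub>"] by auto
      have e: "incl E a = m (a \<otimes>\<^bsub>A\<^esub> inv\<^bsub>A\<^esub> ?u, \<one>\<^bsub>C\<^esub>)"
        using a u by (simp add: m_def 1 B.m_assoc)
      have e': "incl E' a = m' (a \<otimes>\<^bsub>A\<^esub> inv\<^bsub>A\<^esub> ?u, \<one>\<^bsub>C\<^esub>)"
        using a u by (simp add: m'_def 2 B'.m_assoc)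
      show ?thesis unfolding e e' using a u by (intro hm) auto
    qed
  qed
qed

lemma equiv_factor_set:
  assumes E: "is_ext A C E" and "ext_equiv A E E'" "has_factor_set A C E f"
  shows "has_factor_set A C E' f"
proof -
  obtain h where h: "h \<in> iso (mid E) (mid E')" "\<forall>a\<in>carrier A. h (incl E a) = incl E' a"
      "\<forall>b\<in>carrier (mid E). proj E' (h b) = proj E b"
    using assms(2) unfolding ext_equiv_def by blast
  obtain s where s: "section_of A C E s f" using assms(3) by (auto simp: has_factor_set_def)
  have hc: "h x \<in> carrier (mid E')" "h (x \<otimes>\<^bsub>mid E\<^esub> y) = h x \<otimes>\<^bsub>mid E'\<^esub> h y"
    if "x \<in> carrier (mid E)" "y \<in> carrier (mid E)" for x y
    using h(1) that by (auto simp: iso_def hom_def)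
  have "section_of A C E' (h \<circ> s) f"
    unfolding section_of_def
  proof (intro conjI ballI)
    fix c assume "c \<in> carrier C"
    then have "s c \<in> carrier (mid E)" "proj E (s c) = c" using s by (auto simp: section_of_def)
    then show "(h \<circ> s) c \<in> carrier (mid E')" "proj E' ((h \<circ> s) c) = c" using hc h(3) by auto
  next
    fix c d assume cd: "c \<in> carrier C" "d \<in> carrier C"
    have sc: "s x \<in> carrier (mid E)" if "x \<in> carrier C" for x
      using s that by (auto simp: section_of_def)
    have f: "f c d \<in> carrier A" "s c \<otimes>\<^bsub>mid E\<^esub> s d = incl E (f c d) \<otimes>\<^bsub>mid E\<^esub> s (c \<otimes>\<^bsub>C\<^esub> d)"
      using s cd by (auto simp: section_of_def)
    show "f c d \<in> carrier A" by fact
    have "h (s c) \<otimes>\<^bsub>mid E'\<^esub> h (s d) = h (s c \<otimes>\<^bsub>mid E\<^esub> s d)"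
      using sc cd by (simp only: hc(2))
    also have "\<dots> = h (incl E (f c d)) \<otimes>\<^bsub>mid E'\<^esub> h (s (c \<otimes>\<^bsub>C\<^esub> d))"
      unfolding f(2) using sc cd f(1) ext_simps(1)[OF E] by (simp only: hc(2) C.m_closed)
    finally show "(h \<circ> s) c \<otimes>\<^bsub>mid E'\<^esub> (h \<circ> s) d
        = incl E' (f c d) \<otimes>\<^bsub>mid E'\<^esub> (h \<circ> s) (c \<otimes>\<^bsub>C\<^esub> d)"
      using h(2) f(1) by simp
  qed
  then show ?thesis by (auto simp: has_factor_set_def)
qed

lemma split_ext: "is_ext A C (split_ext A C)" "has_factor_set A C (split_ext A C) (\<lambda>_ _. \<one>\<^bsub>A\<^esub>)"
proof -
  have "comm_group (A \<times>\<times> C)"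
    by (rule comm_groupI) (auto simp: A.m_ac C.m_ac intro!: bexI[of _ "inv\<^bsub>A\<^esub> _"] bexI[of _ "inv\<^bsub>C\<^esub> _"])
  then show "is_ext A C (split_ext A C)"
    by (auto simp: is_ext_def split_ext_def mon_def epi_def hom_def inj_on_def kernel_def image_iff)
  show "has_factor_set A C (split_ext A C) (\<lambda>_ _. \<one>\<^bsub>A\<^esub>)"
    unfolding has_factor_set_def section_of_def
    by (intro exI[of _ "\<lambda>c. (\<one>\<^bsub>A\<^esub>, c)"]) (auto simp: split_ext_def)
qed

definition neg where "neg E = E\<lparr>incl := (\<lambda>a. incl E (inv\<^bsub>A\<^esub> a))\<rparr>"

lemma neg_ext:
  assumes E: "is_ext A C E"
  shows "is_ext A C (neg E)"
    "has_factor_set A C E f \<Longrightarrow> has_factor_set A C (neg E) (\<lambda>c d. inv\<^bsub>A\<^esub> f c d)"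
proof -
  have neg: "mid (neg E) = mid E" "proj (neg E) = proj E"
      "incl (neg E) = (\<lambda>a. incl E (inv\<^bsub>A\<^esub> a))" by (simp_all add: neg_def)
  have "a \<in> (\<lambda>a. inv\<^bsub>A\<^esub> a) ` carrier A" if "a \<in> carrier A" for a
    using that by (intro image_eqI[of _ _ "inv\<^bsub>A\<^esub> a"]) auto
  then have "(\<lambda>a. inv\<^bsub>A\<^esub> a) ` carrier A = carrier A" by auto
  then have im: "incl (neg E) ` carrier A = incl E ` carrier A"
    unfolding neg by (metis image_image)
  have "incl (neg E) \<in> hom A (mid E)"
    using ext_simps(1,3)[OF E] by (auto simp: hom_def neg(3) A.inv_mult)
  moreover have "inj_on (incl (neg E)) (carrier A)"
    unfolding neg
  proof (rule inj_onI)
    fix a b assume ab: "a \<in> carrier A" "b \<in> carrier A" "incl E (inv\<^bsub>A\<^esub> a) = incl E (inv\<^bsub>A\<^esub> b)"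
    then have "inv\<^bsub>A\<^esub> a = inv\<^bsub>A\<^esub> b"
      using ext_simps(4)[OF E A.inv_closed[OF ab(1)] A.inv_closed[OF ab(2)]] by blast
    then show "a = b" using A.inv_inv ab(1,2) by metis
  qed
  ultimately show "is_ext A C (neg E)"
    using extD[OF E] im by (simp add: is_ext_def neg(1,2) mon_def epi_def)
  show "has_factor_set A C E f \<Longrightarrow> has_factor_set A C (neg E) (\<lambda>c d. inv\<^bsub>A\<^esub> f c d)"
    by (auto simp: has_factor_set_def section_of_def neg_def)
qed

lemma baer_sum:
  assumes E: "is_ext A C E" and F: "is_ext A C F"
  shows baer_sum_ext: "is_ext A C (baer_sum A E F)"
    and baer_sum_factor_set: "has_factor_set A C E f \<Longrightarrow> has_factor_set A C F g \<Longrightarrow>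
      has_factor_set A C (baer_sum A E F) (\<lambda>c d. f c d \<otimes>\<^bsub>A\<^esub> g c d)"
    and baer_sum_mult: "\<And>x y. x \<in> carrier (fibre_prod E F) \<Longrightarrow> y \<in> carrier (fibre_prod E F) \<Longrightarrow>
      (antidiag A E F #>\<^bsub>fibre_prod E F\<^esub> x) \<otimes>\<^bsub>mid (baer_sum A E F)\<^esub> (antidiag A E F #>\<^bsub>fibre_prod E F\<^esub> y)
       = antidiag A E F #>\<^bsub>fibre_prod E F\<^esub> (x \<otimes>\<^bsub>fibre_prod E F\<^esub> y)"
    and baer_sum_proj: "\<And>x y. (x, y) \<in> carrier (fibre_prod E F) \<Longrightarrow>
      proj (baer_sum A E F) (antidiag A E F #>\<^bsub>fibre_prod E F\<^esub> (x, y)) = proj E x"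
proof -
  interpret B: comm_group "mid E" using extD[OF E] by blast
  interpret D: comm_group "mid F" using extD[OF F] by blast
  interpret p: group_hom "mid E" C "proj E"
    by (simp add: group_hom_def group_hom_axioms_def extD[OF E])
  interpret q: group_hom "mid F" C "proj F"
    by (simp add: group_hom_def group_hom_axioms_def extD[OF F])
  note [simp] = ext_simps[OF E] ext_simps[OF F]
  define P where "P = fibre_prod E F"
  define N where "N = antidiag A E F"
  have Pc: "carrier P = {(x, y) \<in> carrier (mid E) \<times> carrier (mid F). proj E x = proj F y}"
    and Pm: "\<And>x y x' y'. (x, y) \<otimes>\<^bsub>P\<^esub> (x', y') = (x \<otimes>\<^bsub>mid E\<^esub> x', y \<otimes>\<^bsub>mid F\<^esub> y')"
    and P1: "\<one>\<^bsub>P\<^esub> = (\<one>\<^bsub>mid E\<^esub>, \<one>\<^bsub>mid F\<^esub>)"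
    by (auto simp: P_def fibre_prod_def)
  interpret P: comm_group P
  proof (rule comm_groupI)
    show "\<exists>y\<in>carrier P. y \<otimes>\<^bsub>P\<^esub> x = \<one>\<^bsub>P\<^esub>" if "x \<in> carrier P" for x
      using that by (intro bexI[of _ "(inv\<^bsub>mid E\<^esub> fst x, inv\<^bsub>mid F\<^esub> snd x)"]) (auto simp: Pc Pm P1)
  qed (auto simp: Pc Pm P1 B.m_ac D.m_ac)
  have Nmem: "z \<in> N \<longleftrightarrow> (\<exists>a\<in>carrier A. z = (incl E a, inv\<^bsub>mid F\<^esub> incl F a))" for z
    by (auto simp: N_def antidiag_def)
  have NI: "(incl E a, inv\<^bsub>mid F\<^esub> incl F a) \<in> N" if "a \<in> carrier A" for a
    using that Nmem by blast
  have Pinv: "inv\<^bsub>P\<^esub> (x, y) = (inv\<^bsub>mid E\<^esub> x, inv\<^bsub>mid F\<^esub> y)" if "(x, y) \<in> carrier P" for x y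
    using that by (intro P.inv_equality) (auto simp: Pc Pm P1)
  have NP: "N \<subseteq> carrier P" by (auto simp: Nmem Pc)
  have subN: "subgroup N P"
  proof (rule P.subgroupI)
    show "N \<noteq> {}" by (auto simp: N_def antidiag_def)
    show "inv\<^bsub>P\<^esub> x \<in> N" if x: "x \<in> N" for x
    proof -
      obtain a where a: "a \<in> carrier A" "x = (incl E a, inv\<^bsub>mid F\<^esub> incl F a)" using x Nmem by auto
      then have "inv\<^bsub>P\<^esub> x = (incl E (inv\<^bsub>A\<^esub> a), inv\<^bsub>mid F\<^esub> incl F (inv\<^bsub>A\<^esub> a))"
        using Pinv NP x by auto
      then show ?thesis using a by (simp only: NI A.inv_closed A.m_closed)
    qed
    show "x \<otimes>\<^bsub>P\<^esub> y \<in> N" if xy: "x \<in> N" "y \<in> N" for x y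
    proof -
      obtain a b where a: "a \<in> carrier A" "x = (incl E a, inv\<^bsub>mid F\<^esub> incl F a)"
        "b \<in> carrier A" "y = (incl E b, inv\<^bsub>mid F\<^esub> incl F b)" using xy Nmem by metis
      then have "x \<otimes>\<^bsub>P\<^esub> y = (incl E (a \<otimes>\<^bsub>A\<^esub> b), inv\<^bsub>mid F\<^esub> incl F (a \<otimes>\<^bsub>A\<^esub> b))"
        by (simp add: Pm D.inv_mult)
      then show ?thesis using a by (simp only: NI A.inv_closed A.m_closed)
    qed
  qed (rule NP)
  interpret N: normal N P using P.subgroup_imp_normal[OF subN] .
  have eq: "N #>\<^bsub>P\<^esub> x = N #>\<^bsub>P\<^esub> y \<longleftrightarrow> (\<exists>n\<in>N. x = n \<otimes>\<^bsub>P\<^esub> y)"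
    if "x \<in> carrier P" "y \<in> carrier P" for x y
  proof
    assume "N #>\<^bsub>P\<^esub> x = N #>\<^bsub>P\<^esub> y"
    then have "x \<in> N #>\<^bsub>P\<^esub> y" using P.rcos_self[OF that(1) subN] by simp
    then show "\<exists>n\<in>N. x = n \<otimes>\<^bsub>P\<^esub> y" by (auto simp: r_coset_def)
  next
    assume "\<exists>n\<in>N. x = n \<otimes>\<^bsub>P\<^esub> y"
    then have "x \<in> N #>\<^bsub>P\<^esub> y" by (auto simp: r_coset_def)
    then show "N #>\<^bsub>P\<^esub> x = N #>\<^bsub>P\<^esub> y" using P.repr_independence that subN by metis
  qed
  have canc: "inv\<^bsub>A\<^esub> b \<otimes>\<^bsub>A\<^esub> (a \<otimes>\<^bsub>A\<^esub> b) = a" if "a \<in> carrier A" "b \<in> carrier A" for a b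
    using that by (simp add: A.m_comm[of a b] A.m_assoc[symmetric])
  let ?S = "baer_sum A E F"
  have mid: "mid ?S = P Mod N" by (simp add: baer_sum_def P_def N_def)
  have carS: "carrier (mid ?S) = (\<lambda>x. N #>\<^bsub>P\<^esub> x) ` carrier P"
    by (auto simp: mid FactGroup_def RCOSETS_def)
  have mulS: "(N #>\<^bsub>P\<^esub> x) \<otimes>\<^bsub>mid ?S\<^esub> (N #>\<^bsub>P\<^esub> y) = N #>\<^bsub>P\<^esub> (x \<otimes>\<^bsub>P\<^esub> y)"
    if "x \<in> carrier P" "y \<in> carrier P" for x y
    using that by (simp add: mid FactGroup_def N.rcos_sum)
  have incS: "incl ?S a = N #>\<^bsub>P\<^esub> (incl E a, \<one>\<^bsub>mid F\<^esub>)" for a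
    by (simp add: baer_sum_def P_def N_def)
  have inP: "(incl E a, \<one>\<^bsub>mid F\<^esub>) \<in> carrier P" if "a \<in> carrier A" for a
    using that by (simp add: Pc)
  have proS: "proj ?S (N #>\<^bsub>P\<^esub> (x, y)) = proj E x" if xy: "(x, y) \<in> carrier P" for x y
  proof -
    have "(\<lambda>(x, y). proj E x) ` (N #>\<^bsub>P\<^esub> (x, y)) \<subseteq> {proj E x}"
      using xy by (auto simp: r_coset_def Nmem Pm Pc)
    moreover have "proj E x \<in> (\<lambda>(x, y). proj E x) ` (N #>\<^bsub>P\<^esub> (x, y))"
      using P.rcos_self[OF xy subN] by force
    ultimately have "(\<lambda>(x, y). proj E x) ` (N #>\<^bsub>P\<^esub> (x, y)) = {proj E x}" by blast
    then show ?thesis by (simp add: baer_sum_def P_def N_def)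
  qed
  have "is_ext A C ?S"
    unfolding is_ext_def mon_def epi_def
  proof (intro conjI CollectI)
    show "comm_group (mid ?S)" unfolding mid by (rule P.abelian_FactGroup[OF subN])
    show "incl ?S \<in> hom A (mid ?S)"
      by (auto simp: hom_def incS mulS inP carS Pm)
    show "inj_on (incl ?S) (carrier A)"
    proof (rule inj_onI)
      fix a b assume ab: "a \<in> carrier A" "b \<in> carrier A" "incl ?S a = incl ?S b"
      then obtain n where "n \<in> N" "(incl E a, \<one>\<^bsub>mid F\<^esub>) = n \<otimes>\<^bsub>P\<^esub> (incl E b, \<one>\<^bsub>mid F\<^esub>)"
        using eq[OF inP inP] by (auto simp: incS)
      then obtain c where c: "c \<in> carrier A" "incl E a = incl E c \<otimes>\<^bsub>mid E\<^esub> incl E b"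
        "\<one>\<^bsub>mid F\<^esub> = inv\<^bsub>mid F\<^esub> incl F c" by (auto simp: Nmem Pm)
      have "incl F c = incl F \<one>\<^bsub>A\<^esub>"
        using D.inv_inv[of "incl F c"] c(1) unfolding c(3)[symmetric] by simp
      then have "c = \<one>\<^bsub>A\<^esub>" using c(1) ext_simps(4)[OF F] by blast
      then show "a = b" using c ab by simp
    qed
    show "proj ?S \<in> hom (mid ?S) C"
      unfolding hom_def carS by (auto simp: mulS proS Pm) (auto simp: Pc proS Pm mulS)
    have "carrier C \<subseteq> proj ?S ` carrier (mid ?S)"
    proof
      fix c assume c: "c \<in> carrier C"
      have "c \<in> proj E ` carrier (mid E)" "c \<in> proj F ` carrier (mid F)"
        using extD(5)[OF E] extD(5)[OF F] c by simp_all
      then obtain x y where xy: "x \<in> carrier (mid E)" "c = proj E x" "y \<in> carrier (mid F)" "c = proj F y"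
        by blast
      then have P: "(x, y) \<in> carrier P" by (simp add: Pc)
      then have "N #>\<^bsub>P\<^esub> (x, y) \<in> carrier (mid ?S)" unfolding carS by blast
      then show "c \<in> proj ?S ` carrier (mid ?S)" using proS[OF P] xy by (metis image_eqI)
    qed
    moreover have "proj ?S ` carrier (mid ?S) \<subseteq> carrier C"
      unfolding carS by (auto simp: proS) (auto simp: Pc)
    ultimately show "proj ?S ` carrier (mid ?S) = carrier C" by blast
    show "incl ?S ` carrier A = kernel (mid ?S) C (proj ?S)"
    proof
      show "incl ?S ` carrier A \<subseteq> kernel (mid ?S) C (proj ?S)"
        by (auto simp: kernel_def incS proS inP carS)
      show "kernel (mid ?S) C (proj ?S) \<subseteq> incl ?S ` carrier A"
      proof
        fix K assume K: "K \<in> kernel (mid ?S) C (proj ?S)"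
        then obtain x y where xy: "(x, y) \<in> carrier P" "K = N #>\<^bsub>P\<^esub> (x, y)"
          by (auto simp: kernel_def carS)
        then have "proj E x = \<one>\<^bsub>C\<^esub>" "proj F y = \<one>\<^bsub>C\<^esub>"
          using K by (auto simp: kernel_def proS) (auto simp: Pc)
        then have "x \<in> incl E ` carrier A" "y \<in> incl F ` carrier A"
          using xy extD(6)[OF E] extD(6)[OF F] by (auto simp: kernel_def Pc)
        then obtain a b where ab: "a \<in> carrier A" "x = incl E a" "b \<in> carrier A" "y = incl F b"
          by auto
        let ?n = "(incl E (inv\<^bsub>A\<^esub> b), inv\<^bsub>mid F\<^esub> incl F (inv\<^bsub>A\<^esub> b))"
        have "?n \<in> N" using ab by (simp only: NI A.inv_closed)
        moreover have "(x, y) = ?n \<otimes>\<^bsub>P\<^esub> (incl E (a \<otimes>\<^bsub>A\<^esub> b), \<one>\<^bsub>mid F\<^esub>)"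
        proof -
          have "incl E (inv\<^bsub>A\<^esub> b) \<otimes>\<^bsub>mid E\<^esub> incl E (a \<otimes>\<^bsub>A\<^esub> b) = incl E a"
            using ab canc by (simp only: ext_simps(3)[OF E, symmetric] A.inv_closed A.m_closed)
          then show ?thesis using ab by (simp only: Pm) simp
        qed
        ultimately have "K = incl ?S (a \<otimes>\<^bsub>A\<^esub> b)"
          unfolding incS xy(2) eq[OF xy(1) inP[OF A.m_closed[OF ab(1,3)]]] by blast
        then show "K \<in> incl ?S ` carrier A" using ab by blast
      qed
    qed
  qed
  then show "is_ext A C ?S" .
  show "has_factor_set A C ?S (\<lambda>c d. f c d \<otimes>\<^bsub>A\<^esub> g c d)"
    if fg: "has_factor_set A C E f" "has_factor_set A C F g"
  proof -
    obtain s t where s: "section_of A C E s f" and t: "section_of A C F t g"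
      using fg by (auto simp: has_factor_set_def)
    have st: "s c \<in> carrier (mid E)" "proj E (s c) = c" "t c \<in> carrier (mid F)" "proj F (t c) = c"
      if "c \<in> carrier C" for c
      using s t that by (auto simp: section_of_def)
    have f: "f c d \<in> carrier A" "s c \<otimes>\<^bsub>mid E\<^esub> s d = incl E (f c d) \<otimes>\<^bsub>mid E\<^esub> s (c \<otimes>\<^bsub>C\<^esub> d)"
      "g c d \<in> carrier A" "t c \<otimes>\<^bsub>mid F\<^esub> t d = incl F (g c d) \<otimes>\<^bsub>mid F\<^esub> t (c \<otimes>\<^bsub>C\<^esub> d)"
      if "c \<in> carrier C" "d \<in> carrier C" for c d
      using s t that by (auto simp: section_of_def)
    have stP: "(s c, t c) \<in> carrier P" if "c \<in> carrier C" for c using st that by (simp add: Pc)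
    have "section_of A C ?S (\<lambda>c. N #>\<^bsub>P\<^esub> (s c, t c)) (\<lambda>c d. f c d \<otimes>\<^bsub>A\<^esub> g c d)"
      unfolding section_of_def
    proof (intro conjI ballI)
      fix c d assume cd: "c \<in> carrier C" "d \<in> carrier C"
      let ?n = "(incl E (inv\<^bsub>A\<^esub> g c d), inv\<^bsub>mid F\<^esub> incl F (inv\<^bsub>A\<^esub> g c d))"
      let ?y = "(incl E (f c d \<otimes>\<^bsub>A\<^esub> g c d), \<one>\<^bsub>mid F\<^esub>) \<otimes>\<^bsub>P\<^esub> (s (c \<otimes>\<^bsub>C\<^esub> d), t (c \<otimes>\<^bsub>C\<^esub> d))"
      have "?n \<in> N" using f(3)[OF cd] by (simp only: NI A.inv_closed)
      moreover have "(s c, t c) \<otimes>\<^bsub>P\<^esub> (s d, t d) = ?n \<otimes>\<^bsub>P\<^esub> ?y"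
      proof -
        let ?k = "c \<otimes>\<^bsub>C\<^esub> d"
        have k: "s ?k \<in> carrier (mid E)" "t ?k \<in> carrier (mid F)" using st cd by auto
        have "incl E (inv\<^bsub>A\<^esub> g c d) \<otimes>\<^bsub>mid E\<^esub> incl E (f c d \<otimes>\<^bsub>A\<^esub> g c d) = incl E (f c d)"
          using f[OF cd] canc by (simp only: ext_simps(3)[OF E, symmetric] A.inv_closed A.m_closed)
        then have "incl E (inv\<^bsub>A\<^esub> g c d) \<otimes>\<^bsub>mid E\<^esub> (incl E (f c d \<otimes>\<^bsub>A\<^esub> g c d) \<otimes>\<^bsub>mid E\<^esub> s ?k)
            = incl E (f c d) \<otimes>\<^bsub>mid E\<^esub> s ?k"
          using f(1,3)[OF cd] k by (metis B.m_assoc ext_simps(1)[OF E] A.inv_closed A.m_closed)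
        then show ?thesis using f[OF cd] k by (simp only: Pm) simp
      qed
      moreover have "?y \<in> carrier P" 
        using inP[OF A.m_closed[OF f(1,3)[OF cd]]] stP[OF C.m_closed[OF cd]] by (rule P.m_closed)
      ultimately have "N #>\<^bsub>P\<^esub> ((s c, t c) \<otimes>\<^bsub>P\<^esub> (s d, t d)) = N #>\<^bsub>P\<^esub> ?y"
        using eq[OF P.m_closed[OF stP stP]] cd by blast
      then show "(N #>\<^bsub>P\<^esub> (s c, t c)) \<otimes>\<^bsub>mid ?S\<^esub> (N #>\<^bsub>P\<^esub> (s d, t d)) =
          incl ?S (f c d \<otimes>\<^bsub>A\<^esub> g c d) \<otimes>\<^bsub>mid ?S\<^esub> (N #>\<^bsub>P\<^esub> (s (c \<otimes>\<^bsub>C\<^esub> d), t (c \<otimes>\<^bsub>C\<^esub> d)))"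
        unfolding incS mulS[OF stP[OF cd(1)] stP[OF cd(2)]]
          mulS[OF inP[OF A.m_closed[OF f(1,3)[OF cd]]] stP[OF C.m_closed[OF cd]]] .
    qed (use f stP st in \<open>auto simp: carS proS\<close>)
    then show ?thesis by (auto simp: has_factor_set_def)
  qed
  show "(antidiag A E F #>\<^bsub>fibre_prod E F\<^esub> x) \<otimes>\<^bsub>mid ?S\<^esub> (antidiag A E F #>\<^bsub>fibre_prod E F\<^esub> y)
       = antidiag A E F #>\<^bsub>fibre_prod E F\<^esub> (x \<otimes>\<^bsub>fibre_prod E F\<^esub> y)"
    if "x \<in> carrier (fibre_prod E F)" "y \<in> carrier (fibre_prod E F)" for x y
    using mulS that by (simp add: P_def N_def)
  show "proj ?S (antidiag A E F #>\<^bsub>fibre_prod E F\<^esub> (x, y)) = proj E x"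
    if "(x, y) \<in> carrier (fibre_prod E F)" for x y
    using proS that by (simp add: P_def N_def)
qed

lemma Ext_carrier: "carrier (Ext C A) = {ext_class C A E |E :: ('a, 'a \<times> 'c, 'c) extn. is_ext A C E}"
  by (auto simp: Ext_def quotient_def ext_rel_def ext_class_def Image_def)

lemma factor_class:
  fixes E :: "('a, 'b, 'c) extn"
  assumes E: "is_ext A C E" "has_factor_set A C E f"
  shows "ext_class C A E = {E'. is_ext A C E' \<and> has_factor_set A C E' f}"
  using factor_set_equiv[OF E(1) _ E(2)] equiv_factor_set[OF E(1) _ E(2)]
  unfolding ext_class_def by blast

definition fclass :: "('c \<Rightarrow> 'c \<Rightarrow> 'a) \<Rightarrow> ('a, 'a \<times> 'c, 'c) extn set" where
  "fclass f = {E. is_ext A C E \<and> has_factor_set A C E f}"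

lemma Ext_carrier_fclass: "carrier (Ext C A) = {fclass f |f. fclass f \<noteq> {}}"
proof (intro equalityI subsetI)
  fix X assume "X \<in> carrier (Ext C A)"
  then obtain E :: "('a, 'a \<times> 'c, 'c) extn" where E: "is_ext A C E" "X = ext_class C A E"
    unfolding Ext_carrier by blast
  obtain f where f: "has_factor_set A C E f" using factor_set_exists[OF E(1)] by blast
  then show "X \<in> {fclass f |f. fclass f \<noteq> {}}" using E factor_class[OF E(1) f] by (auto simp: fclass_def)
next
  fix X assume "X \<in> {fclass f |f. fclass f \<noteq> {}}"
  then obtain f E where X: "X = fclass f" "E \<in> X" by blast
  then have E: "is_ext A C E" "has_factor_set A C E f" by (auto simp: fclass_def)
  then have "X = ext_class C A E" using X(1) factor_class[OF E] by (simp add: fclass_def)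
  then show "X \<in> carrier (Ext C A)" unfolding Ext_carrier using E(1) by blast
qed

lemma fclass_nonempty:
  assumes "is_ext A C E" "has_factor_set A C E f" shows "fclass f \<noteq> {}"
  using ext_representative[OF assms(1)] equiv_factor_set[OF assms(1) _ assms(2)]
  by (auto simp: fclass_def)

lemma Ext_mult:
  assumes "fclass f \<noteq> {}" "fclass g \<noteq> {}"
  shows "fclass f \<otimes>\<^bsub>Ext C A\<^esub> fclass g = fclass (\<lambda>c d. f c d \<otimes>\<^bsub>A\<^esub> g c d)"
    "fclass (\<lambda>c d. f c d \<otimes>\<^bsub>A\<^esub> g c d) \<noteq> {}"
proof -
  have *: "ext_class C A (baer_sum A E F) = fclass (\<lambda>c d. f c d \<otimes>\<^bsub>A\<^esub> g c d)"
    if "E \<in> fclass f" "F \<in> fclass g" for E F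
    using factor_class[OF baer_sum_ext baer_sum_factor_set, of E F f g] that
    unfolding fclass_def by simp
  then show "fclass f \<otimes>\<^bsub>Ext C A\<^esub> fclass g = fclass (\<lambda>c d. f c d \<otimes>\<^bsub>A\<^esub> g c d)"
    using assms by (auto simp: Ext_def)
  obtain E F where "E \<in> fclass f" "F \<in> fclass g" using assms by blast
  then show "fclass (\<lambda>c d. f c d \<otimes>\<^bsub>A\<^esub> g c d) \<noteq> {}"
    using fclass_nonempty[OF baer_sum_ext baer_sum_factor_set, of E F f g] by (simp add: fclass_def)
qed

lemma Ext_one: "\<one>\<^bsub>Ext C A\<^esub> = fclass (\<lambda>_ _. \<one>\<^bsub>A\<^esub>)"  "fclass (\<lambda>_ _. \<one>\<^bsub>A\<^esub>) \<noteq> {}"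
  using factor_class[OF split_ext] fclass_nonempty[OF split_ext] by (auto simp: Ext_def fclass_def)

lemma fclass_cong:
  assumes "\<And>c d. c \<in> carrier C \<Longrightarrow> d \<in> carrier C \<Longrightarrow> f c d = g c d"
  shows "fclass f = fclass g"
  using assms by (simp add: fclass_def has_factor_set_def section_of_def)

lemma fclass_closed:
  assumes "fclass f \<noteq> {}" "c \<in> carrier C" "d \<in> carrier C" shows "f c d \<in> carrier A"
  using assms by (auto simp: fclass_def has_factor_set_def section_of_def)

theorem Ext_comm_group: "comm_group (Ext C A)"
proof (rule comm_groupI)
  fix X Y Z assume "X \<in> carrier (Ext C A)" "Y \<in> carrier (Ext C A)" "Z \<in> carrier (Ext C A)"
  then obtain f g h where f: "X = fclass f" "fclass f \<noteq> {}"
    and g: "Y = fclass g" "fclass g \<noteq> {}" and h: "Z = fclass h" "fclass h \<noteq> {}"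
    unfolding Ext_carrier_fclass by blast
  note c = fclass_closed[OF f(2)] fclass_closed[OF g(2)] fclass_closed[OF h(2)]
  show "X \<otimes>\<^bsub>Ext C A\<^esub> Y \<otimes>\<^bsub>Ext C A\<^esub> Z = X \<otimes>\<^bsub>Ext C A\<^esub> (Y \<otimes>\<^bsub>Ext C A\<^esub> Z)"
    using f g h by (simp add: Ext_mult, intro fclass_cong) (simp add: c A.m_assoc)
next
  fix X Y assume "X \<in> carrier (Ext C A)" "Y \<in> carrier (Ext C A)"
  then obtain f g where f: "X = fclass f" "fclass f \<noteq> {}"
    and g: "Y = fclass g" "fclass g \<noteq> {}"
    unfolding Ext_carrier_fclass by blast
  note c = fclass_closed[OF f(2)] fclass_closed[OF g(2)]
  show "X \<otimes>\<^bsub>Ext C A\<^esub> Y \<in> carrier (Ext C A)"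
    using Ext_mult[OF f(2) g(2)] f g unfolding Ext_carrier_fclass by auto
  show "X \<otimes>\<^bsub>Ext C A\<^esub> Y = Y \<otimes>\<^bsub>Ext C A\<^esub> X"
    using f g by (simp add: Ext_mult, intro fclass_cong) (simp add: c A.m_comm)
next
  show "\<one>\<^bsub>Ext C A\<^esub> \<in> carrier (Ext C A)" using Ext_one unfolding Ext_carrier_fclass by blast
next
  fix X assume "X \<in> carrier (Ext C A)"
  then obtain f where f: "X = fclass f" "fclass f \<noteq> {}" unfolding Ext_carrier_fclass by blast
  note c = fclass_closed[OF f(2)]
  show "\<one>\<^bsub>Ext C A\<^esub> \<otimes>\<^bsub>Ext C A\<^esub> X = X"
    using f by (simp add: Ext_mult Ext_one, intro fclass_cong) (simp add: c)
  have n: "fclass (\<lambda>c d. inv\<^bsub>A\<^esub> f c d) \<noteq> {}"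
    using f neg_ext unfolding fclass_def by blast
  then have "fclass (\<lambda>c d. inv\<^bsub>A\<^esub> f c d) \<otimes>\<^bsub>Ext C A\<^esub> X = \<one>\<^bsub>Ext C A\<^esub>"
    using f by (simp add: Ext_mult Ext_one, intro fclass_cong) (simp add: c)
  then show "\<exists>Y\<in>carrier (Ext C A). Y \<otimes>\<^bsub>Ext C A\<^esub> X = \<one>\<^bsub>Ext C A\<^esub>"
    using n unfolding Ext_carrier_fclass by blast
qed

lemma pure_ext_iff:
  assumes E: "is_ext A C E"
  shows "pure_ext A E \<longleftrightarrow> (\<forall>n::nat. n > 0 \<longrightarrow> (\<forall>c\<in>carrier C. c [^]\<^bsub>C\<^esub> n = \<one>\<^bsub>C\<^esub> \<longrightarrow>
    (\<exists>b\<in>carrier (mid E). proj E b = c \<and> b [^]\<^bsub>mid E\<^esub> n = \<one>\<^bsub>mid E\<^esub>)))"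
    (is "_ = ?R")
proof -
  interpret B: comm_group "mid E" using extD[OF E] by blast
  interpret p: group_hom "mid E" C "proj E"
    by (simp add: group_hom_def group_hom_axioms_def extD[OF E])
  interpret i: group_hom A "mid E" "incl E"
    by (simp add: group_hom_def group_hom_axioms_def extD[OF E])
  let ?H = "incl E ` carrier A"
  have sub: "subgroup ?H (mid E)" by (rule i.img_is_subgroup)
  show ?thesis
  proof
    assume pure: "pure_ext A E"
    show ?R
    proof (intro allI impI ballI)
      fix n :: nat and c assume n: "n > 0" and c: "c \<in> carrier C" "c [^]\<^bsub>C\<^esub> n = \<one>\<^bsub>C\<^esub>"
      have "c \<in> proj E ` carrier (mid E)" using c extD(5)[OF E] by simp
      then obtain b where b: "b \<in> carrier (mid E)" "c = proj E b" by blast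
      have "b [^]\<^bsub>mid E\<^esub> n \<in> kernel (mid E) C (proj E)"
        using b c by (simp add: kernel_def p.hom_nat_pow)
      then have "b [^]\<^bsub>mid E\<^esub> n \<in> ?H \<inter> (\<lambda>x. x [^]\<^bsub>mid E\<^esub> n) ` carrier (mid E)"
        using b extD(6)[OF E] by simp
      then have "b [^]\<^bsub>mid E\<^esub> n \<in> (\<lambda>x. x [^]\<^bsub>mid E\<^esub> n) ` ?H"
        using pure n by (simp add: pure_ext_def pure_subgroup_def)
      then obtain a where a: "a \<in> carrier A" "b [^]\<^bsub>mid E\<^esub> n = incl E a [^]\<^bsub>mid E\<^esub> n" by auto
      have ia: "incl E a \<in> carrier (mid E)" using a by simp
      have "(b \<otimes>\<^bsub>mid E\<^esub> inv\<^bsub>mid E\<^esub> incl E a) [^]\<^bsub>mid E\<^esub> n = \<one>\<^bsub>mid E\<^esub>"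
        using a b ia by (simp add: B.nat_pow_distrib B.nat_pow_inv)
      moreover have "proj E (b \<otimes>\<^bsub>mid E\<^esub> inv\<^bsub>mid E\<^esub> incl E a) = c"
        using a b ia ext_simps(2)[OF E] by simp
      ultimately show "\<exists>b\<in>carrier (mid E). proj E b = c \<and> b [^]\<^bsub>mid E\<^esub> n = \<one>\<^bsub>mid E\<^esub>"
        using b ia by (intro bexI[of _ "b \<otimes>\<^bsub>mid E\<^esub> inv\<^bsub>mid E\<^esub> incl E a"] conjI) simp_all
    qed
  next
    assume R: ?R
    have "(\<lambda>x. x [^]\<^bsub>mid E\<^esub> n) ` ?H = ?H \<inter> (\<lambda>x. x [^]\<^bsub>mid E\<^esub> n) ` carrier (mid E)"
      if n: "n > 0" for n :: nat
    proof
      show "(\<lambda>x. x [^]\<^bsub>mid E\<^esub> n) ` ?H \<subseteq> ?H \<inter> (\<lambda>x. x [^]\<^bsub>mid E\<^esub> n) ` carrier (mid E)"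
      proof (clarify, intro IntI)
        fix a assume a: "a \<in> carrier A"
        show "incl E a [^]\<^bsub>mid E\<^esub> n \<in> ?H" 
          unfolding i.hom_nat_pow[OF a, symmetric] using a by (intro imageI A.nat_pow_closed)
        show "incl E a [^]\<^bsub>mid E\<^esub> n \<in> (\<lambda>x. x [^]\<^bsub>mid E\<^esub> n) ` carrier (mid E)" using a by simp
      qed
      show "?H \<inter> (\<lambda>x. x [^]\<^bsub>mid E\<^esub> n) ` carrier (mid E) \<subseteq> (\<lambda>x. x [^]\<^bsub>mid E\<^esub> n) ` ?H"
      proof
        fix y assume "y \<in> ?H \<inter> (\<lambda>x. x [^]\<^bsub>mid E\<^esub> n) ` carrier (mid E)"
        then obtain a b where y: "a \<in> carrier A" "y = incl E a" "b \<in> carrier (mid E)"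
          "y = b [^]\<^bsub>mid E\<^esub> n" by blast
        have "proj E b [^]\<^bsub>C\<^esub> n = \<one>\<^bsub>C\<^esub>"
          using y ext_simps(2)[OF E y(1)] p.hom_nat_pow[OF y(3), of n] by simp
        then obtain b' where b': "b' \<in> carrier (mid E)" "proj E b' = proj E b"
          "b' [^]\<^bsub>mid E\<^esub> n = \<one>\<^bsub>mid E\<^esub>" using R n p.hom_closed[OF y(3)] by blast
        then obtain d where d: "d \<in> carrier A" "b = incl E d \<otimes>\<^bsub>mid E\<^esub> b'"
          using fibre[OF E y(3) b'(1)] by auto
        then have "y = incl E d [^]\<^bsub>mid E\<^esub> n"
          using y(4) b' by (simp add: B.nat_pow_distrib)
        then show "y \<in> (\<lambda>x. x [^]\<^bsub>mid E\<^esub> n) ` ?H" using d by blast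
      qed
    qed
    then show "pure_ext A E" using sub by (simp add: pure_ext_def pure_subgroup_def)
  qed
qed

lemma pure_ext_equiv:
  assumes E: "is_ext A C E" and F: "is_ext A C F" and EF: "ext_equiv A E F" and pure: "pure_ext A E"
  shows "pure_ext A F"
proof -
  obtain h where h: "h \<in> iso (mid E) (mid F)" "\<forall>b\<in>carrier (mid E). proj F (h b) = proj E b"
    using EF unfolding ext_equiv_def by blast
  interpret B: comm_group "mid E" using extD[OF E] by blast
  interpret D: comm_group "mid F" using extD[OF F] by blast
  interpret h: group_hom "mid E" "mid F" h
    using h(1) by (auto simp: group_hom_def group_hom_axioms_def iso_def)
  show ?thesis unfolding pure_ext_iff[OF F]
  proof (intro allI impI ballI)
    fix n :: nat and c assume "n > 0" "c \<in> carrier C" "c [^]\<^bsub>C\<^esub> n = \<one>\<^bsub>C\<^esub>"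
    then obtain b where "b \<in> carrier (mid E)" "proj E b = c" "b [^]\<^bsub>mid E\<^esub> n = \<one>\<^bsub>mid E\<^esub>"
      using pure unfolding pure_ext_iff[OF E] by blast
    then show "\<exists>b\<in>carrier (mid F). proj F b = c \<and> b [^]\<^bsub>mid F\<^esub> n = \<one>\<^bsub>mid F\<^esub>"
      using h(2) h.hom_nat_pow[of b n] by (intro bexI[of _ "h b"]) auto
  qed
qed

lemma pure_split_ext: "pure_ext A (split_ext A C)"
  unfolding pure_ext_iff[OF split_ext(1)]
proof (intro allI impI ballI)
  fix n :: nat and c assume c: "c \<in> carrier C" "c [^]\<^bsub>C\<^esub> n = \<one>\<^bsub>C\<^esub>"
  have "(\<one>\<^bsub>A\<^esub>, c) [^]\<^bsub>A \<times>\<times> C\<^esub> m = (\<one>\<^bsub>A\<^esub>, c [^]\<^bsub>C\<^esub> m)" for m :: nat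
    by (induction m) (simp_all add: nat_pow_def)
  with c show "\<exists>b\<in>carrier (mid (split_ext A C)). proj (split_ext A C) b = c \<and>
      b [^]\<^bsub>mid (split_ext A C)\<^esub> n = \<one>\<^bsub>mid (split_ext A C)\<^esub>"
    by (intro bexI[of _ "(\<one>\<^bsub>A\<^esub>, c)"]) (auto simp: split_ext_def)
qed

lemma pure_baer_sum:
  assumes E: "is_ext A C E" and F: "is_ext A C F" and "pure_ext A E" "pure_ext A F"
  shows "pure_ext A (baer_sum A E F)"
  unfolding pure_ext_iff[OF baer_sum_ext[OF E F]]
proof (intro allI impI ballI)
  interpret B: comm_group "mid E" using extD[OF E] by blast
  interpret D: comm_group "mid F" using extD[OF F] by blast
  interpret p: group_hom "mid E" C "proj E"
    by (simp add: group_hom_def group_hom_axioms_def extD[OF E])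
  interpret q: group_hom "mid F" C "proj F"
    by (simp add: group_hom_def group_hom_axioms_def extD[OF F])
  let ?S = "baer_sum A E F" and ?P = "fibre_prod E F" and ?N = "antidiag A E F"
  interpret S: comm_group "mid ?S" using extD[OF baer_sum_ext[OF E F]] by blast
  fix n :: nat and c assume n: "n > 0" and c: "c \<in> carrier C" "c [^]\<^bsub>C\<^esub> n = \<one>\<^bsub>C\<^esub>"
  obtain x where x: "x \<in> carrier (mid E)" "proj E x = c" "x [^]\<^bsub>mid E\<^esub> n = \<one>\<^bsub>mid E\<^esub>"
    using assms(3) n c unfolding pure_ext_iff[OF E] by blast
  obtain y where y: "y \<in> carrier (mid F)" "proj F y = c" "y [^]\<^bsub>mid F\<^esub> n = \<one>\<^bsub>mid F\<^esub>"
    using assms(4) n c unfolding pure_ext_iff[OF F] by blast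
  have P: "(x [^]\<^bsub>mid E\<^esub> m, y [^]\<^bsub>mid F\<^esub> m) \<in> carrier ?P" for m :: nat
    using x y by (simp add: fibre_prod_def p.hom_nat_pow q.hom_nat_pow)
  have P1: "(x, y) \<in> carrier ?P" using x y by (simp add: fibre_prod_def)
  have one: "\<one>\<^bsub>mid ?S\<^esub> = ?N #>\<^bsub>?P\<^esub> (\<one>\<^bsub>mid E\<^esub>, \<one>\<^bsub>mid F\<^esub>)"
    using extD(2)[OF baer_sum_ext[OF E F]] ext_simps(7)[OF baer_sum_ext[OF E F]] ext_simps(7)[OF E]
    by (simp add: baer_sum_def)
  have pow: "(?N #>\<^bsub>?P\<^esub> (x, y)) [^]\<^bsub>mid ?S\<^esub> m = ?N #>\<^bsub>?P\<^esub> (x [^]\<^bsub>mid E\<^esub> m, y [^]\<^bsub>mid F\<^esub> m)"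
    for m :: nat
  proof (induction m)
    case 0
    show ?case by (simp add: one)
  next
    case (Suc m)
    have "(?N #>\<^bsub>?P\<^esub> (x, y)) [^]\<^bsub>mid ?S\<^esub> Suc m
        = (?N #>\<^bsub>?P\<^esub> (x [^]\<^bsub>mid E\<^esub> m, y [^]\<^bsub>mid F\<^esub> m)) \<otimes>\<^bsub>mid ?S\<^esub> (?N #>\<^bsub>?P\<^esub> (x, y))"
      by (simp only: S.nat_pow_Suc Suc)
    also have "\<dots> = ?N #>\<^bsub>?P\<^esub> ((x [^]\<^bsub>mid E\<^esub> m, y [^]\<^bsub>mid F\<^esub> m) \<otimes>\<^bsub>?P\<^esub> (x, y))"
      by (rule baer_sum_mult[OF E F P P1])
    finally show ?case by (simp add: fibre_prod_def)
  qed
  show "\<exists>b\<in>carrier (mid ?S). proj ?S b = c \<and> b [^]\<^bsub>mid ?S\<^esub> n = \<one>\<^bsub>mid ?S\<^esub>"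
  proof (intro bexI conjI)
    show "proj ?S (?N #>\<^bsub>?P\<^esub> (x, y)) = c" using baer_sum_proj[OF E F P1] x by simp
    show "(?N #>\<^bsub>?P\<^esub> (x, y)) [^]\<^bsub>mid ?S\<^esub> n = \<one>\<^bsub>mid ?S\<^esub>" by (simp add: pow one x y)
    show "?N #>\<^bsub>?P\<^esub> (x, y) \<in> carrier (mid ?S)"
      using P1 by (auto simp: baer_sum_def FactGroup_def RCOSETS_def)
  qed
qed

theorem Pext_subgroup: "subgroup {X \<in> carrier (Ext C A). \<exists>E\<in>X. pure_ext A E} (Ext C A)"
proof -
  interpret Ext: comm_group "Ext C A" by (rule Ext_comm_group)
  let ?U = "{X \<in> carrier (Ext C A). \<exists>E\<in>X. pure_ext A E}"
  show ?thesis
  proof (rule Ext.subgroupI)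
    have "split_ext A C \<in> \<one>\<^bsub>Ext C A\<^esub>"
      using split_ext(1) ext_equiv_refl by (auto simp: Ext_def ext_class_def)
    then show "?U \<noteq> {}" using pure_split_ext Ext.one_closed by blast
  next
    fix X assume "X \<in> ?U"
    then obtain f E where X: "X \<in> carrier (Ext C A)" "X = fclass f" "E \<in> X" "pure_ext A E"
      unfolding Ext_carrier_fclass by blast
    then have E: "is_ext A C E" "has_factor_set A C E f" by (auto simp: fclass_def)
    have neg: "neg E \<in> fclass (\<lambda>c d. inv\<^bsub>A\<^esub> f c d)" 
      unfolding fclass_def using neg_ext(1)[OF E(1)] neg_ext(2)[OF E] by blast
    have f: "fclass f \<noteq> {}" using X by blast
    have n: "fclass (\<lambda>c d. inv\<^bsub>A\<^esub> f c d) \<noteq> {}" using neg by blast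
    then have nc: "fclass (\<lambda>c d. inv\<^bsub>A\<^esub> f c d) \<in> carrier (Ext C A)"
      unfolding Ext_carrier_fclass by blast
    have "fclass (\<lambda>c d. inv\<^bsub>A\<^esub> f c d) \<otimes>\<^bsub>Ext C A\<^esub> X = \<one>\<^bsub>Ext C A\<^esub>"
      using f n X(2) by (simp add: Ext_mult Ext_one, intro fclass_cong) (simp add: fclass_closed[OF f])
    then have "inv\<^bsub>Ext C A\<^esub> X = fclass (\<lambda>c d. inv\<^bsub>A\<^esub> f c d)"
      using X(1) nc by (rule Ext.inv_equality)
    moreover have "pure_ext A (neg E)"
      using X(4) unfolding pure_ext_iff[OF E(1)] pure_ext_iff[OF neg_ext(1)[OF E(1)]]
      by (simp add: neg_def)
    ultimately show "inv\<^bsub>Ext C A\<^esub> X \<in> ?U" using neg nc by auto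
  next
    fix X Y assume "X \<in> ?U" "Y \<in> ?U"
    then obtain E F where X: "X \<in> carrier (Ext C A)" "E \<in> X" "pure_ext A E"
      and Y: "Y \<in> carrier (Ext C A)" "F \<in> Y" "pure_ext A F" by blast
    then have E: "is_ext A C E" and F: "is_ext A C F"
      unfolding Ext_carrier_fclass by (auto simp: fclass_def)
    obtain G :: "('a, 'a \<times> 'c, 'c) extn" where G: "is_ext A C G" "ext_equiv A (baer_sum A E F) G"
      using ext_representative[OF baer_sum_ext[OF E F]] by blast
    have "G \<in> X \<otimes>\<^bsub>Ext C A\<^esub> Y"
      using G X(2) Y(2) by (auto simp: Ext_def ext_class_def)
    moreover have "pure_ext A G"
      using pure_ext_equiv[OF baer_sum_ext[OF E F] G] pure_baer_sum[OF E F X(3) Y(3)] by blast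
    ultimately show "X \<otimes>\<^bsub>Ext C A\<^esub> Y \<in> ?U" using X Y Ext.m_closed by blast
  qed blast
qed

corollary Pext_comm_group: "comm_group (Pext C A)"
proof -
  interpret Ext: comm_group "Ext C A" by (rule Ext_comm_group)
  interpret Pext: group "Pext C A"
    unfolding Pext_def by (rule subgroup.subgroup_is_group[OF Pext_subgroup Ext.is_group])
  show ?thesis
    by (rule Pext.group_comm_groupI) (simp add: Pext_def Ext.m_comm)
qed

end
end

theory Submission
  imports Defs
begin

text \<open>
  Let \<open>E\<close> be a pure extension of a torsion group \<open>C\<close> by a torsion-free group \<open>A\<close>.  Purity says
  that every element of finite order in \<open>C\<close> lifts to an element of finite order in the middle
  group, so here every element of \<open>C\<close> has such a lift.  It has only one: two lifts differ by an
  element of \<open>A\<close>, and this element has finite order, hence is trivial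
  (\<open>eq_of_finite_order\<close>).  Products of elements of finite order again have finite order, so by
  uniqueness the lift of a product is the product of the lifts.  The lifting is therefore a
  homomorphic section, its factor set is trivial, and \<open>E\<close> represents the neutral element of
  \<open>Ext C A\<close>.
\<close>

lemma (in comm_group) nat_pow_mult_eq_one:
  assumes x: "x \<in> carrier G" "x [^] (m::nat) = \<one>" and y: "y \<in> carrier G" "y [^] (n::nat) = \<one>"
  shows "(x \<otimes> y) [^] (m * n) = \<one>"
proof -
  have "x [^] (m * n) = \<one>" using x by (simp flip: nat_pow_pow)
  moreover have "y [^] (m * n) = \<one>" using y by (simp add: mult.commute[of m] flip: nat_pow_pow)
  ultimately show ?thesis using x y by (simp add: nat_pow_distrib)
qed

text \<open>
  Torsion-freeness of \<open>A\<close> enters here: \<open>x\<close> and \<open>y\<close> differ by an element of \<open>A\<close> killed by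
  \<open>m * n\<close>.  Hence an element of \<open>C\<close> has at most one lift of finite order.
\<close>

lemma (in ab_pair) eq_of_finite_order:
  assumes E: "is_ext A C E" and tf: "torsion_free_group A"
    and x: "x \<in> carrier (mid E)" "m > 0" "x [^]\<^bsub>mid E\<^esub> (m::nat) = \<one>\<^bsub>mid E\<^esub>"
    and y: "y \<in> carrier (mid E)" "n > 0" "y [^]\<^bsub>mid E\<^esub> (n::nat) = \<one>\<^bsub>mid E\<^esub>"
    and xy: "proj E x = proj E y"
  shows "x = y"
proof -
  interpret B: comm_group "mid E" using extD[OF E] by blast
  interpret i: group_hom A "mid E" "incl E"
    by (simp add: group_hom_def group_hom_axioms_def extD[OF E])
  obtain a where a: "a \<in> carrier A" "x = incl E a \<otimes>\<^bsub>mid E\<^esub> y"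
    using fibre[OF E x(1) y(1) xy] by blast
  have "incl E a = x \<otimes>\<^bsub>mid E\<^esub> inv\<^bsub>mid E\<^esub> y"
    using a y(1) by (simp add: B.m_assoc)
  moreover have "(inv\<^bsub>mid E\<^esub> y) [^]\<^bsub>mid E\<^esub> n = \<one>\<^bsub>mid E\<^esub>"
    using y by (simp add: B.nat_pow_inv)
  ultimately have "incl E a [^]\<^bsub>mid E\<^esub> (m * n) = \<one>\<^bsub>mid E\<^esub>"
    using B.nat_pow_mult_eq_one x y(1) by simp
  then have "incl E (a [^]\<^bsub>A\<^esub> (m * n)) = incl E \<one>\<^bsub>A\<^esub>"
    using a(1) by (simp add: i.hom_nat_pow)
  then have "a [^]\<^bsub>A\<^esub> (m * n) = \<one>\<^bsub>A\<^esub>"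
    using a(1) ext_simps(4)[OF E] by blast
  then have "a = \<one>\<^bsub>A\<^esub>"
    using tf a(1) x(2) y(2) unfolding torsion_free_group_def by (metis nat_0_less_mult_iff)
  then show ?thesis using a(2) y(1) by simp
qed

text \<open>
  The section consists of the lifts of finite order, which exist by purity.  The product of two
  of them and the lift of the product both have finite order over the same element of \<open>C\<close>, so
  they coincide.
\<close>

lemma (in ab_pair) pure_ext_trivial_factor_set:
  assumes E: "is_ext A C E" and pure: "pure_ext A E"
    and tf: "torsion_free_group A" and t: "torsion_group C"
  shows "has_factor_set A C E (\<lambda>_ _. \<one>\<^bsub>A\<^esub>)"
proof -
  interpret B: comm_group "mid E" using extD[OF E] by blast
  have "\<exists>b n. b \<in> carrier (mid E) \<and> proj E b = c \<and> n > 0 \<and> b [^]\<^bsub>mid E\<^esub> (n::nat) = \<one>\<^bsub>mid E\<^esub>"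
    if "c \<in> carrier C" for c
    using that t pure unfolding pure_ext_iff[OF E] torsion_group_def by meson
  then obtain s n where s: "\<And>c. c \<in> carrier C \<Longrightarrow> s c \<in> carrier (mid E)"
    "\<And>c. c \<in> carrier C \<Longrightarrow> proj E (s c) = c"
    "\<And>c. c \<in> carrier C \<Longrightarrow> n c > (0::nat)"
    "\<And>c. c \<in> carrier C \<Longrightarrow> s c [^]\<^bsub>mid E\<^esub> n c = \<one>\<^bsub>mid E\<^esub>"
    by metis
  have "s c \<otimes>\<^bsub>mid E\<^esub> s d = s (c \<otimes>\<^bsub>C\<^esub> d)" if cd: "c \<in> carrier C" "d \<in> carrier C" for c d
  proof (rule eq_of_finite_order[OF E tf])
    show "(s c \<otimes>\<^bsub>mid E\<^esub> s d) [^]\<^bsub>mid E\<^esub> (n c * n d) = \<one>\<^bsub>mid E\<^esub>"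
      using s cd by (intro B.nat_pow_mult_eq_one) auto
    show "s (c \<otimes>\<^bsub>C\<^esub> d) [^]\<^bsub>mid E\<^esub> n (c \<otimes>\<^bsub>C\<^esub> d) = \<one>\<^bsub>mid E\<^esub>"
      using s(4) cd by simp
  qed (use s cd in \<open>simp_all add: ext_simps[OF E]\<close>)
  then have "section_of A C E s (\<lambda>_ _. \<one>\<^bsub>A\<^esub>)"
    using s(1,2) by (simp add: section_of_def ext_simps(7)[OF E])
  then show ?thesis unfolding has_factor_set_def by blast
qed

theorem corollary2p2:
  fixes A :: "'a monoid" and C :: "'c monoid"
  assumes "comm_group A" and "torsion_free_group A"
    and "comm_group C" and "torsion_group C"
  shows "trivial_group (Pext C A)"
proof -
  interpret ab_pair A C using assms(1,3) by (simp add: ab_pair_def)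
  interpret P: comm_group "Pext C A" by (rule Pext_comm_group)
  have "X = \<one>\<^bsub>Pext C A\<^esub>" if XP: "X \<in> carrier (Pext C A)" for X
  proof -
    obtain f E where X: "X = fclass f" "E \<in> X" "pure_ext A E"
      using XP unfolding Pext_def Ext_carrier_fclass by auto
    then have E: "is_ext A C E" "has_factor_set A C E f" by (auto simp: fclass_def)
    have "X = ext_class C A E"
      using X(1) factor_class[OF E] by (simp add: fclass_def)
    also have "\<dots> = fclass (\<lambda>_ _. \<one>\<^bsub>A\<^esub>)"
      using factor_class[OF E(1) pure_ext_trivial_factor_set[OF E(1) X(3) assms(2,4)]]
      by (simp add: fclass_def)
    also have "\<dots> = \<one>\<^bsub>Pext C A\<^esub>" by (simp add: Pext_def Ext_one(1))
    finally show ?thesis .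
  qed
  then show ?thesis unfolding P.trivial_group_subset by blast
qed

end
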